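(* Let $\epsilon_n$ ($n\ge 0$) be Carlitz's $q$-Euler numbers, $$\epsilon_n=\frac{1}{(1-q)^n}\sum_{k=0}^n(-1)^k\binom{n}{k}\frac{1+q}{1+q^{k+1}}.$$ Then for every integer $n\ge 0$ the following three identities hold in $\mathbb{Q}(q)$: $$\det_{0\le i,j\le n}(\epsilon_{i+j}) = \frac{(-1)^{\binom{n+1}{2}}q^{\frac{1}{4}\binom{2n+2}{3}}}{(1-q)^{n(n+1)}} \prod_{k=1}^n \frac{(q^2,q^2;q^2)_k}{(-q,-q^2,-q^2,-q^3;q^2)_k},$$ $$\det_{0\le i,j\le n}(\epsilon_{i+j+1}) = \frac{(-1)^{\binom{n+2}{2}}q^{\frac{1}{4}\binom{2n+4}{3}}}{(1-q)^{n(n+1)} (1+q^2)^{n+1}} \prod_{k=1}^n \frac{(q^2,q^4;q^2)_k}{(-q^2,-q^3,-q^3,-q^4;q^2)_k},$$ $$\det_{0\le i,j\le n}(\epsilon_{i+j+2}) = \frac{(-1)^{\binom{n+2}{2}}q^{\frac{1}{4}\binom{2n+4}{3}} (1+q)^n \big(1-(-1)^n q^{(n+2)^2}\big)}{(1-q)^{n(n+1)} (1+q^2)^{2(n+1)} (1+q^3)^{n+1}} \prod_{k=1}^n \frac{(q^4,q^4;q^2)_k}{(-q^3,-q^4,-q^4,-q^5;q^2)_k}.$$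
   Context: $q$ is an indeterminate, and all quantities lie in the field $\mathbb{Q}(q)$. For an integer $N\ge 0$, $(A;Q)_N:=\prod_{k=0}^{N-1}(1-AQ^k)$ and $(A,B,\ldots,C;Q)_N:=(A;Q)_N(B;Q)_N\cdots(C;Q)_N$. For a sequence $(s_n)$, $\det_{0\le i,j\le n}(s_{i+j})$ is the determinant of the $(n+1)\times(n+1)$ Hankel matrix with $(i,j)$ entry $s_{i+j}$, $0\le i,j\le n$. Empty products equal $1$. *)

theory Defs
  imports "Jordan_Normal_Form.Determinant"
begin

text \<open>The field \<open>\<rat>(q)\<close> is the fraction field of the polynomial ring \<open>\<rat>[q]\<close>.\<close>

definition q :: "rat poly fract"
  where "q = to_fract [:0, 1:]"

definition qpoch :: "'a::comm_ring_1 \<Rightarrow> 'a \<Rightarrow> nat \<Rightarrow> 'a"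
  where "qpoch A Q N = (\<Prod>k<N. 1 - A * Q ^ k)"

text \<open>\<open>qpochs [A, B, \<dots>, C] Q N\<close> is \<open>(A, B, \<dots>, C; Q)\<^sub>N\<close>.\<close>

definition qpochs :: "'a::comm_ring_1 list \<Rightarrow> 'a \<Rightarrow> nat \<Rightarrow> 'a"
  where "qpochs As Q N = (\<Prod>A\<leftarrow>As. qpoch A Q N)"

definition qEuler :: "nat \<Rightarrow> rat poly fract"
  where "qEuler n =
    1 / (1 - q) ^ n * (\<Sum>k\<le>n. (-1) ^ k * of_nat (n choose k) * ((1 + q) / (1 + q ^ (k + 1))))"

text \<open>\<open>hankel_det s n\<close> is a determinant of order \<open>n + 1\<close>: the indices range over \<open>0, \<dots>, n\<close>.\<close>

definition hankel_det :: "(nat \<Rightarrow> 'a::comm_ring_1) \<Rightarrow> nat \<Rightarrow> 'a"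
  where "hankel_det s n = det (mat (n + 1) (n + 1) (\<lambda>(i, j). s (i + j)))"

text \<open>The denominators of \<open>qEuler\<close>, and all factors \<open>1 + q ^ m\<close>, are nonzero, so no
  division by zero occurs.\<close>

lemma q_power: "q ^ m = to_fract (monom 1 m)"
proof (induction m)
  case 0
  show ?case by (simp add: monom_0 flip: one_pCons)
next
  case (Suc m)
  have "monom (1::rat) (Suc m) = [:0, 1:] * monom 1 m" by (simp add: monom_Suc)
  then show ?case using Suc by (simp only: power_Suc q_def to_fract_mult)
qed

lemma one_plus_q_power_nonzero: "1 + q ^ m \<noteq> 0"
proof -
  have "poly (1 + monom (1::rat) m) 1 \<noteq> 0" by (simp add: poly_monom)
  then have "1 + monom (1::rat) m \<noteq> 0" by force
  then have "to_fract (1 + monom (1::rat) m) \<noteq> 0" by (simp only: to_fract_eq_0_iff not_False_eq_True)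
  then show ?thesis by (simp add: q_power)
qed

lemma one_minus_q_nonzero: "1 - q \<noteq> 0"
proof -
  have "to_fract (1 - [:0, 1::rat:]) \<noteq> 0" by (simp only: to_fract_eq_0_iff) (simp add: one_pCons)
  then show ?thesis by (simp only: q_def to_fract_diff to_fract_1 not_False_eq_True)
qed

text \<open>One quarter of \<open>2 * m choose 3\<close> is an integer, so \<open>div\<close> is exact on it.\<close>

lemma four_dvd_choose: "4 dvd (2 * m choose 3)"
proof (induction m)
  case 0
  show ?case by (simp add: binomial_eq_0)
next
  case (Suc m)
  have "2 * Suc m choose 3 = (2 * m choose 3) + (2 * (2 * m choose 2) + 2 * m)"
    by (simp add: numeral_3_eq_3 numeral_2_eq_2)
  also have "2 * (2 * m choose 2) + 2 * m = 4 * m ^ 2"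
    by (cases m) (simp_all add: choose_two power2_eq_square algebra_simps)
  finally show ?case using Suc by simp
qed

end

theory Submission
  imports Defs "Jordan_Normal_Form.Char_Poly"
begin

text \<open>
  The numbers \<open>\<epsilon>\<^sub>n\<close> are, up to \<open>(1 - q)\<^sup>n\<close>, the binomial transform of
  \<open>\<mu>\<^sub>k = (1 + q) / (1 + q\<^bsup>k+1\<^esup>)\<close>, and a binomial transform does not change Hankel determinants. The
  \<open>\<mu>\<^sub>k\<close> are moments \<open>(A; q)\<^sub>k / (A c; q)\<^sub>k\<close> of little \<open>q\<close>-Jacobi polynomials, with \<open>A = -q\<close> and
  \<open>c = q\<close>; differencing them, which shifts the index of \<open>\<epsilon>\<close> by one, leads to \<open>c = q\<^sup>2\<close>. Shifting the
  index of such moments replaces \<open>A\<close> by \<open>A q\<close>, so Desnanot-Jacobi condensation evaluates their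
  Hankel determinants by induction on the size. The weight of the third determinant is no longer of
  this type, but condensation expresses it through the first two.
\<close>

section \<open>Condensation of determinants\<close>

text \<open>Row 0 vanishes outside columns \<open>0\<close> and \<open>N + 1\<close>, so expansion
  along it leaves two terms. With \<open>u\<close> and \<open>v\<close> the outer columns of an
  adjugate, the value becomes the difference of products in the condensation formula.\<close>

lemma det_unit_outside_outer_columns:
  fixes u v :: "nat \<Rightarrow> 'a::comm_ring_1"
  shows "det (mat (N + 2) (N + 2) (\<lambda>(i, j). if j = 0 then u i else if j = N + 1 then v i
           else if i = j then 1 else 0)) = u 0 * v (N + 1) - v 0 * u (N + 1)"
    (is "det ?M = _")
proof -
  have 1: "mat_delete ?M 0 0 = mat (N + 1) (N + 1) (\<lambda>(i, j). if j = N then v (Suc i)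
      else if i = j then 1 else 0)" (is "_ = ?K")
    by (rule eq_matI) (auto simp: mat_delete_def)
  have "det ?K = prod_list (diag_mat ?K)"
    by (rule det_upper_triangular[of _ "N + 1"]) auto
  also have "diag_mat ?K = map (\<lambda>i. if i = N then v (Suc N) else 1) [0..<Suc N]"
    by (auto simp: diag_mat_def simp del: upt_Suc)
  also have "prod_list \<dots> = v (N + 1)"
  proof -
    have "map (\<lambda>i. if i = N then v (Suc N) else 1) [0..<N] = map (\<lambda>i. 1) [0..<N]"
      by (rule map_cong) auto
    then show ?thesis by (simp add: map_replicate_const)
  qed
  finally have 2: "det ?K = v (N + 1)" .
  let ?L = "mat (N + 1) (N + 1) (\<lambda>(i, j). if j = 0 then u (Suc i) else if Suc i = j then 1 else 0)"
  have 3: "mat_delete ?M 0 (N + 1) = ?L"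
    by (rule eq_matI) (auto simp: mat_delete_def)
  have "det ?L = (\<Sum>j<N + 1. ?L $$ (N, j) * cofactor ?L N j)"
    by (rule laplace_expansion_row) auto
  also have "\<dots> = (\<Sum>j<N + 1. if j = 0 then u (N + 1) * cofactor ?L N 0 else 0)"
    by (rule sum.cong) auto
  also have "\<dots> = u (N + 1) * cofactor ?L N 0"
    by (simp del: sum.lessThan_Suc)
  also have "mat_delete ?L N 0 = 1\<^sub>m N"
    by (rule eq_matI) (auto simp: mat_delete_def)
  then have "cofactor ?L N 0 = (-1) ^ N"
    by (simp add: cofactor_def)
  finally have 4: "det ?L = u (N + 1) * (-1) ^ N" .
  have "det ?M = (\<Sum>j<N + 2. ?M $$ (0, j) * cofactor ?M 0 j)"
    by (rule laplace_expansion_row) auto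
  also have "\<dots> = (\<Sum>j<N + 2. if j = 0 then u 0 * cofactor ?M 0 0 else 0)
      + (\<Sum>j<N + 2. if j = N + 1 then v 0 * cofactor ?M 0 (N + 1) else 0)"
    unfolding sum.distrib[symmetric] by (rule sum.cong) auto
  also have "\<dots> = u 0 * cofactor ?M 0 0 + v 0 * cofactor ?M 0 (N + 1)"
    by (simp del: sum.lessThan_Suc)
  also have "\<dots> = u 0 * v (N + 1) - v 0 * u (N + 1)"
    unfolding cofactor_def 1 2 3 4 by (simp add: algebra_simps flip: power_add)
  finally show ?thesis .
qed

text \<open>Multiplying a matrix by the outer columns of its adjugate gives unit vectors scaled by
  the determinant \<open>d\<close>. Two column expansions peel off both factors.\<close>

lemma det_scaled_unit_outer_columns:
  fixes f :: "nat \<Rightarrow> nat \<Rightarrow> 'a::comm_ring_1"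
  shows "det (mat (N + 2) (N + 2) (\<lambda>(i, j). if j = 0 \<or> j = N + 1 then if i = j then d else 0
           else f i j)) = d * d * det (mat N N (\<lambda>(i, j). f (i + 1) (j + 1)))"
    (is "det ?M = _")
proof -
  let ?K = "mat (N + 1) (N + 1) (\<lambda>(i, j). if j = N then if i = j then d else 0
           else f (Suc i) (Suc j))"
  have 1: "mat_delete ?M 0 0 = ?K"
    by (rule eq_matI) (auto simp: mat_delete_def)
  have 2: "mat_delete ?K N N = mat N N (\<lambda>(i, j). f (i + 1) (j + 1))"
    by (rule eq_matI) (auto simp: mat_delete_def)
  have "det ?M = (\<Sum>i<N + 2. ?M $$ (i, 0) * cofactor ?M i 0)"
    by (rule laplace_expansion_column) auto
  also have "\<dots> = (\<Sum>i<N + 2. if i = 0 then d * cofactor ?M 0 0 else 0)"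
    by (rule sum.cong) auto
  also have "\<dots> = d * det ?K"
    unfolding cofactor_def 1 by (simp del: sum.lessThan_Suc)
  also have "det ?K = (\<Sum>i<N + 1. ?K $$ (i, N) * cofactor ?K i N)"
    by (rule laplace_expansion_column) auto
  also have "\<dots> = (\<Sum>i<N + 1. if i = N then d * cofactor ?K N N else 0)"
    by (rule sum.cong) auto
  also have "\<dots> = d * det (mat N N (\<lambda>(i, j). f (i + 1) (j + 1)))"
    unfolding cofactor_def 2 by (simp flip: power_add del: sum.lessThan_Suc)
  finally show ?thesis by (simp add: mult.assoc)
qed

text \<open>Let \<open>?M\<close> be the identity matrix with its outer columns replaced by those of
  the adjugate of \<open>A\<close>. Then \<open>A * ?M\<close> keeps the inner columns of
  \<open>A\<close> and has \<open>det A\<close> times unit vectors at the ends. Taking determinants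
  and cancelling one \<open>det A\<close> gives the claim, whence the hypothesis
  \<open>nz\<close>.\<close>

lemma desnanot_jacobi_aux:
  fixes f :: "nat \<Rightarrow> nat \<Rightarrow> 'a::idom" and N :: nat
  defines "A \<equiv> mat (N + 2) (N + 2) (\<lambda>(i, j). f i j)"
  assumes nz: "det A \<noteq> 0"
  shows "det A * det (mat N N (\<lambda>(i, j). f (i + 1) (j + 1))) =
    det (mat (N + 1) (N + 1) (\<lambda>(i, j). f i j)) *
      det (mat (N + 1) (N + 1) (\<lambda>(i, j). f (i + 1) (j + 1))) -
    det (mat (N + 1) (N + 1) (\<lambda>(i, j). f (i + 1) j)) *
      det (mat (N + 1) (N + 1) (\<lambda>(i, j). f i (j + 1)))"
proof -
  let ?c = "\<lambda>j i. adj_mat A $$ (i, j)"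
  let ?M = "mat (N + 2) (N + 2) (\<lambda>(i, j). if j = 0 then ?c 0 i else if j = N + 1 then ?c (N + 1) i
           else if i = j then 1 else 0)"
  have A: "A \<in> carrier_mat (N + 2) (N + 2)" by (simp add: A_def)
  have AA: "(A * adj_mat A) $$ (i, j) = (if i = j then det A else 0)" if "i < N + 2" "j < N + 2" for i j
    using adj_mat(2)[OF A] that by simp
  have "A * ?M = mat (N + 2) (N + 2) (\<lambda>(i, j). if j = 0 \<or> j = N + 1 then if i = j then det A else 0
           else f i j)" (is "_ = ?P")
  proof (rule eq_matI)
    fix i j assume "i < dim_row ?P" "j < dim_col ?P"
    then have ij: "i < N + 2" "j < N + 2" by auto
    have *: "(A * ?M) $$ (i, j) = (\<Sum>k<N + 2. A $$ (i, k) * ?M $$ (k, j))"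
      using ij A by (simp add: scalar_prod_def atLeast0LessThan)
    show "(A * ?M) $$ (i, j) = ?P $$ (i, j)"
    proof (cases "j = 0 \<or> j = N + 1")
      case True
      have "(A * adj_mat A) $$ (i, j) = (\<Sum>k<N + 2. A $$ (i, k) * adj_mat A $$ (k, j))"
        using ij A adj_mat(1)[OF A] by (simp add: scalar_prod_def atLeast0LessThan)
      also have "\<dots> = (A * ?M) $$ (i, j)"
        unfolding * using True by (intro sum.cong) auto
      finally show ?thesis using AA[OF ij] ij True by auto
    next
      case False
      have "(A * ?M) $$ (i, j) = (\<Sum>k<N + 2. if k = j then f i j else 0)"
        unfolding * using False ij by (intro sum.cong) (auto simp: A_def)
      then show ?thesis using False ij by (simp del: sum.lessThan_Suc)
    qed
  qed (use A in auto)
  then have "det A * det ?M = det ?P"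
    using det_mult[of A "N + 2" ?M] A by simp
  then have "det A * det ?M = det A * (det A * det (mat N N (\<lambda>(i, j). f (i + 1) (j + 1))))"
    by (simp only: det_scaled_unit_outer_columns mult.assoc)
  then have "det ?M = det A * det (mat N N (\<lambda>(i, j). f (i + 1) (j + 1)))"
    using nz by simp
  moreover have "det ?M = ?c 0 0 * ?c (N + 1) (N + 1) - ?c (N + 1) 0 * ?c 0 (N + 1)"
    by (rule det_unit_outside_outer_columns)
  moreover have "?c 0 0 = det (mat (N + 1) (N + 1) (\<lambda>(i, j). f (i + 1) (j + 1)))"
    unfolding adj_mat_def using A
    by (auto simp: cofactor_def mat_delete_def A_def intro!: arg_cong[of _ _ det])
  moreover have "?c (N + 1) (N + 1) = det (mat (N + 1) (N + 1) (\<lambda>(i, j). f i j))"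
    unfolding adj_mat_def using A
    by (auto simp: cofactor_def mat_delete_def A_def simp flip: power_add intro!: arg_cong[of _ _ det])
  \<comment> \<open>The adjugate transposes: its entry \<open>(0, N + 1)\<close> is the cofactor
    that deletes the last row and the first column. The signs of the two mixed cofactors cancel in
    their product.\<close>
  moreover have "?c (N + 1) 0 = (-1) ^ (N + 1) * det (mat (N + 1) (N + 1) (\<lambda>(i, j). f i (j + 1)))"
    unfolding adj_mat_def using A
    by (auto simp: cofactor_def mat_delete_def A_def intro!: arg_cong[of _ _ det])
  moreover have "?c 0 (N + 1) = (-1) ^ (N + 1) * det (mat (N + 1) (N + 1) (\<lambda>(i, j). f (i + 1) j))"
    unfolding adj_mat_def using A
    by (auto simp: cofactor_def mat_delete_def A_def intro!: arg_cong[of _ _ det])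
  ultimately show ?thesis by (simp add: algebra_simps flip: power_add)
qed

text \<open>The perturbation \<open>f + X I\<close> has determinant a characteristic polynomial, hence nonzero;
  the identity for \<open>f\<close> is its constant term.\<close>

theorem desnanot_jacobi:
  fixes f :: "nat \<Rightarrow> nat \<Rightarrow> 'a::idom"
  shows "det (mat (N + 2) (N + 2) (\<lambda>(i, j). f i j)) * det (mat N N (\<lambda>(i, j). f (i + 1) (j + 1))) =
    det (mat (N + 1) (N + 1) (\<lambda>(i, j). f i j)) *
      det (mat (N + 1) (N + 1) (\<lambda>(i, j). f (i + 1) (j + 1))) -
    det (mat (N + 1) (N + 1) (\<lambda>(i, j). f (i + 1) j)) *
      det (mat (N + 1) (N + 1) (\<lambda>(i, j). f i (j + 1)))"
proof -
  define F where "F i j = [:f i j:] + (if i = j then [:0, 1:] else 0)" for i j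
  \<comment> \<open>The minus sign makes \<open>char_poly_matrix A\<close>, that is X I -
    \<open>A\<close>, equal to the matrix of \<open>F\<close>.\<close>
  define A where "A = mat (N + 2) (N + 2) (\<lambda>(i, j). - f i j)"
  have eval: "poly (det (mat m m (\<lambda>(i, j). F (g i) (h j)))) 0 = det (mat m m (\<lambda>(i, j). f (g i) (h j)))"
    for m g h
  proof -
    show ?thesis
      unfolding comm_ring_hom.hom_det[OF poly_hom.comm_ring_hom_axioms, symmetric] by (rule arg_cong[of _ _ det], rule eq_matI) (auto simp: F_def)
  qed
  have "mat (N + 2) (N + 2) (\<lambda>(i, j). F i j) = char_poly_matrix A"
    by (rule eq_matI) (auto simp: F_def char_poly_matrix_def A_def)
  then have "det (mat (N + 2) (N + 2) (\<lambda>(i, j). F i j)) = char_poly A"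
    by (simp add: char_poly_def)
  also have "\<dots> \<noteq> 0"
    using degree_monic_char_poly[of A "N + 2"] by (auto simp: A_def)
  finally have "poly (det (mat (N + 2) (N + 2) (\<lambda>(i, j). F i j)) * det (mat N N (\<lambda>(i, j). F (i + 1) (j + 1)))) 0 =
    poly (det (mat (N + 1) (N + 1) (\<lambda>(i, j). F i j)) *
      det (mat (N + 1) (N + 1) (\<lambda>(i, j). F (i + 1) (j + 1))) -
    det (mat (N + 1) (N + 1) (\<lambda>(i, j). F (i + 1) j)) *
      det (mat (N + 1) (N + 1) (\<lambda>(i, j). F i (j + 1)))) 0"
    by (subst desnanot_jacobi_aux) auto
  then show ?thesis
    by (simp only: poly_mult poly_diff
        eval[of _ "\<lambda>i. i" "\<lambda>i. i"] eval[of _ "\<lambda>i. i + 1" "\<lambda>i. i"]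
        eval[of _ "\<lambda>i. i" "\<lambda>i. i + 1"] eval[of _ "\<lambda>i. i + 1" "\<lambda>i. i + 1"])
qed

section \<open>Hankel determinants and the binomial transform\<close>

text \<open>The order is \<open>N\<close> rather than \<open>N + 1\<close>, so that condensation can
  start from the empty determinant.\<close>

definition hankel_minor :: "(nat \<Rightarrow> 'a::comm_ring_1) \<Rightarrow> nat \<Rightarrow> 'a"
  where "hankel_minor s N = det (mat N N (\<lambda>(i, j). s (i + j)))"

lemma hankel_det_conv_minor: "hankel_det s n = hankel_minor s (Suc n)"
  by (simp add: hankel_det_def hankel_minor_def)

lemma hankel_minor_0 [simp]: "hankel_minor s 0 = 1"
  by (simp add: hankel_minor_def)

lemma hankel_minor_1 [simp]: "hankel_minor s (Suc 0) = s 0"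
  by (simp add: hankel_minor_def det_single)

text \<open>In a Hankel matrix the two mixed minors are the same determinant, with the index raised
  by one; hence the square.\<close>

lemma hankel_minor_condensation:
  fixes s :: "nat \<Rightarrow> 'a::idom"
  shows "hankel_minor s (N + 2) * hankel_minor (\<lambda>k. s (k + 2)) N =
    hankel_minor s (N + 1) * hankel_minor (\<lambda>k. s (k + 2)) (N + 1) -
    hankel_minor (\<lambda>k. s (k + 1)) (N + 1) ^ 2"
  using desnanot_jacobi[where f = "\<lambda>i j. s (i + j)" and N = N]
  by (simp add: hankel_minor_def power2_eq_square)

lemma prod_list_map_upt: "prod_list (map f [0..<N]) = (\<Prod>i<N. f i :: 'a::comm_monoid_mult)"
  by (induction N) (auto simp: mult.commute)

text \<open>Since \<open>x ^ (i + j) = x ^ i * x ^ j\<close>, the matrix is that of \<open>s\<close>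
  between two diagonal matrices. The scalar \<open>a\<close> is put into the left one only.\<close>

lemma hankel_minor_scale:
  fixes s :: "nat \<Rightarrow> 'a::comm_ring_1"
  shows "hankel_minor (\<lambda>k. a * x ^ k * s k) N = a ^ N * x ^ (N * (N - 1)) * hankel_minor s N"
proof -
  let ?D = "\<lambda>a. mat N N (\<lambda>(i, j). if i = j then a * x ^ i else 0) :: 'a mat"
  let ?S = "mat N N (\<lambda>(i, j). s (i + j))"
  have D: "det (?D a) = a ^ N * (\<Prod>i<N. x ^ i)" for a
  proof -
    have "det (?D a) = prod_list (diag_mat (?D a))"
      by (rule det_upper_triangular[of _ N]) auto
    also have "diag_mat (?D a) = map (\<lambda>i. a * x ^ i) [0..<N]"
      by (auto simp: diag_mat_def)
    finally show ?thesis by (simp add: prod_list_map_upt prod.distrib)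
  qed
  have sq: "(\<Prod>i<N. x ^ i) * (\<Prod>i<N. x ^ i) = x ^ (N * (N - 1))"
  proof (induction N)
    case (Suc N)
    have "Suc N * N = N * (N - 1) + N + N" by (cases N) auto
    then show ?case using Suc by (simp add: power_add) (simp add: algebra_simps)
  qed simp
  have "mat N N (\<lambda>(i, j). a * x ^ (i + j) * s (i + j)) = ?D a * (?S * ?D 1)"
  proof (rule eq_matI)
    fix i j assume "i < dim_row (?D a * (?S * ?D 1))" "j < dim_col (?D a * (?S * ?D 1))"
    then have ij: "i < N" "j < N" by auto
    have *: "(?S * ?D 1) $$ (k, j) = s (k + j) * x ^ j" if "k < N" for k
    proof -
      have "(?S * ?D 1) $$ (k, j) = (\<Sum>l<N. s (k + l) * (if l = j then 1 * x ^ l else 0))"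
        using that ij by (simp add: scalar_prod_def atLeast0LessThan)
      also have "\<dots> = (\<Sum>l<N. if l = j then s (k + j) * x ^ j else 0)"
        by (rule sum.cong) auto
      finally have "(?S * ?D 1) $$ (k, j) = (\<Sum>l<N. if l = j then s (k + j) * x ^ j else 0)" .
      then show ?thesis using ij by simp
    qed
    have "(?D a * (?S * ?D 1)) $$ (i, j) = (\<Sum>k<N. ?D a $$ (i, k) * (?S * ?D 1) $$ (k, j))"
      using ij by (simp add: scalar_prod_def atLeast0LessThan)
    also have "\<dots> = (\<Sum>k<N. if k = i then a * x ^ i * (s (i + j) * x ^ j) else 0)"
      using ij by (intro sum.cong) (auto simp: * simp del: index_mult_mat(1))
    finally show "mat N N (\<lambda>(i, j). a * x ^ (i + j) * s (i + j)) $$ (i, j) =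
        (?D a * (?S * ?D 1)) $$ (i, j)"
      using ij by (simp add: power_add mult_ac)
  qed auto
  moreover have "det (?D a * (?S * ?D 1)) = det (?D a) * det (?S * ?D 1)"
    by (rule det_mult) auto
  moreover have "det (?S * ?D 1) = det ?S * det (?D 1)"
    by (rule det_mult) auto
  ultimately have "hankel_minor (\<lambda>k. a * x ^ k * s k) N = det (?D a) * (det ?S * det (?D 1))"
    unfolding hankel_minor_def by simp
  then show ?thesis
    unfolding D sq[symmetric] hankel_minor_def by (simp only: power_one mult_1_left mult_ac)
qed

text \<open>This is the n-th power of 1 - E, with E the shift of sequences, applied to
  \<open>m\<close> and evaluated at 0.\<close>

definition binom_transform :: "(nat \<Rightarrow> 'a::comm_ring_1) \<Rightarrow> nat \<Rightarrow> 'a"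
  where "binom_transform m n = (\<Sum>k\<le>n. (-1) ^ k * of_nat (n choose k) * m k)"

text \<open>Pascal's rule splits off one factor 1 - E. Raising the index of a transform thus
  differences the sequence being transformed.\<close>

lemma binom_transform_Suc:
  "binom_transform m (Suc n) = binom_transform (\<lambda>k. m k - m (Suc k)) n"
proof -
  have "binom_transform m (Suc n) =
      m 0 + (\<Sum>k\<le>n. (-1) ^ Suc k * of_nat (Suc n choose Suc k) * m (Suc k))"
    unfolding binom_transform_def sum.atMost_Suc_shift by simp
  also have "(\<Sum>k\<le>n. (-1) ^ Suc k * of_nat (Suc n choose Suc k) * m (Suc k)) =
      (\<Sum>k\<le>n. (-1) ^ Suc k * of_nat (n choose Suc k) * m (Suc k) -
        (-1) ^ k * of_nat (n choose k) * m (Suc k))"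
    by (rule sum.cong) (simp_all add: algebra_simps)
  also have "m 0 + \<dots> = m 0 + (\<Sum>k\<le>n. (-1) ^ Suc k * of_nat (n choose Suc k) * m (Suc k)) -
      (\<Sum>k\<le>n. (-1) ^ k * of_nat (n choose k) * m (Suc k))"
    by (simp add: sum_subtractf)
  also have "m 0 + (\<Sum>k\<le>n. (-1) ^ Suc k * of_nat (n choose Suc k) * m (Suc k)) =
      (\<Sum>k\<le>Suc n. (-1) ^ k * of_nat (n choose k) * m k)"
    unfolding sum.atMost_Suc_shift by simp
  also have "\<dots> = (\<Sum>k\<le>n. (-1) ^ k * of_nat (n choose k) * m k)"
    by (simp add: binomial_eq_0)
  finally show ?thesis
    unfolding binom_transform_def by (simp add: algebra_simps sum_subtractf)
qed

lemma binom_transform_diff: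
  "binom_transform (\<lambda>k. f k - g k) n = binom_transform f n - binom_transform g n"
  by (simp add: binom_transform_def algebra_simps sum_subtractf)

text \<open>The power of 1 - E with exponent \<open>i + j\<close> factors into one acting on the row
  index and one acting on the column index.\<close>

lemma binom_transform_add:
  "binom_transform m (i + j) = binom_transform (\<lambda>k. binom_transform (\<lambda>l. m (k + l)) j) i"
proof (induction i arbitrary: m)
  case 0
  show ?case by (simp add: binom_transform_def)
next
  case (Suc i)
  have "binom_transform m (Suc i + j) = binom_transform (\<lambda>k. m k - m (Suc k)) (i + j)"
    by (simp add: binom_transform_Suc)
  also have "\<dots> = binom_transform (\<lambda>k. binom_transform (\<lambda>l. m (k + l)) j -
      binom_transform (\<lambda>l. m (Suc k + l)) j) i"
    by (simp add: Suc binom_transform_diff)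
  finally show ?case by (simp add: binom_transform_Suc)
qed

text \<open>By \<open>binom_transform_add\<close>, the transformed Hankel matrix is \<open>B S B\<^sup>T\<close> with \<open>B\<close> lower
  triangular and diagonal entries \<open>\<plusminus>1\<close>.\<close>

lemma hankel_minor_binom_transform:
  "hankel_minor (binom_transform m) N = hankel_minor m N"
proof -
  let ?B = "mat N N (\<lambda>(i, k). (-1) ^ k * of_nat (i choose k)) :: 'a mat"
  let ?S = "mat N N (\<lambda>(i, j). m (i + j))"
  \<comment> \<open>Binomial coefficients vanish beyond \<open>i\<close>, so every sum may run over
    the full matrix index.\<close>
  have ext: "binom_transform f i = (\<Sum>k<N. (-1) ^ k * of_nat (i choose k) * f k)" if "i < N"
    for f :: "nat \<Rightarrow> 'a" and i
    unfolding binom_transform_def using that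
    by (intro sum.mono_neutral_left) (auto simp: binomial_eq_0)
  have "mat N N (\<lambda>(i, j). binom_transform m (i + j)) = ?B * (?S * ?B\<^sup>T)"
  proof (rule eq_matI)
    fix i j assume "i < dim_row (?B * (?S * ?B\<^sup>T))" "j < dim_col (?B * (?S * ?B\<^sup>T))"
    then have ij: "i < N" "j < N" by auto
    have *: "(?S * ?B\<^sup>T) $$ (k, j) = binom_transform (\<lambda>l. m (k + l)) j" if "k < N" for k
      using that ij by (simp add: scalar_prod_def atLeast0LessThan ext mult_ac)
    have "(?B * (?S * ?B\<^sup>T)) $$ (i, j) = (\<Sum>k<N. ?B $$ (i, k) * (?S * ?B\<^sup>T) $$ (k, j))"
      using ij by (simp add: scalar_prod_def atLeast0LessThan)
    also have "\<dots> = (\<Sum>k<N. (-1) ^ k * of_nat (i choose k) * binom_transform (\<lambda>l. m (k + l)) j)"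
      using ij by (intro sum.cong) (auto simp: * simp del: index_mult_mat(1))
    finally show "mat N N (\<lambda>(i, j). binom_transform m (i + j)) $$ (i, j) =
        (?B * (?S * ?B\<^sup>T)) $$ (i, j)"
      using ij by (simp add: binom_transform_add ext)
  qed auto
  moreover have "det (?B * (?S * ?B\<^sup>T)) = det ?B * det (?S * ?B\<^sup>T)"
    by (rule det_mult) auto
  moreover have "det (?S * ?B\<^sup>T) = det ?S * det ?B\<^sup>T"
    by (rule det_mult) auto
  ultimately have "hankel_minor (binom_transform m) N = det ?B * (hankel_minor m N * det ?B\<^sup>T)"
    unfolding hankel_minor_def by simp
  moreover have "det ?B\<^sup>T = det ?B"
    by (rule det_transpose) auto
  moreover have "det ?B = (\<Prod>i<N. (-1) ^ i)"
  proof -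
    have "det ?B = prod_list (diag_mat ?B)"
      by (rule det_lower_triangular[of N]) (auto simp: binomial_eq_0)
    also have "diag_mat ?B = map (\<lambda>i. (-1) ^ i) [0..<N]"
      by (auto simp: diag_mat_def)
    finally show ?thesis by (simp add: prod_list_map_upt)
  qed
  moreover have "(\<Prod>i<N. (-1) ^ i) * (\<Prod>i<N. (-1) ^ i) = (1 :: 'a)"
    by (simp flip: prod.distrib power_add)
  ultimately show ?thesis by (simp add: mult_ac)
qed

section \<open>Moments of the little q-Jacobi polynomials\<close>

lemma qpoch_0 [simp]: "qpoch A Q 0 = 1"
  by (simp add: qpoch_def)

lemma qpoch_Suc: "qpoch A Q (Suc n) = qpoch A Q n * (1 - A * Q ^ n)"
  by (simp add: qpoch_def)

lemma qpoch_Suc_shift: "qpoch A Q (Suc n) = (1 - A) * qpoch (A * Q) Q n"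
  unfolding qpoch_def prod.lessThan_Suc_shift by (simp add: mult_ac)

lemma qpoch_nonzero:
  fixes A :: "'a::idom"
  shows "(\<And>k. A * Q ^ k \<noteq> 1) \<Longrightarrow> qpoch A Q n \<noteq> 0"
  by (induction n) (auto simp: qpoch_Suc)

text \<open>In the usual parameters a, b of the little q-Jacobi polynomials in base
  \<open>Q\<close>, \<open>A\<close> is a\<open>Q\<close> and \<open>c\<close> is b\<open>Q\<close>.
  In this form an index shift changes \<open>A\<close> and leaves \<open>c\<close> alone.\<close>

definition jacobi_moment :: "'a::field \<Rightarrow> 'a \<Rightarrow> 'a \<Rightarrow> nat \<Rightarrow> 'a"
  where "jacobi_moment Q c A k = qpoch A Q k / qpoch (A * c) Q k"

text \<open>For \<open>k = 0\<close> the truncated subtractions make every factor \<open>1\<close>, which is the right value.\<close>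

definition jacobi_norm :: "'a::field \<Rightarrow> 'a \<Rightarrow> 'a \<Rightarrow> nat \<Rightarrow> 'a"
  where "jacobi_norm Q c A k = A ^ k * Q ^ (k * (k - 1)) * qpoch A Q k * qpoch Q Q k * qpoch c Q k *
    qpoch (A * c) Q (k - 1) / (qpoch (A * c) Q (2 * k - 1) * qpoch (A * c) Q (2 * k))"

text \<open>The quotient of the order \<open>n\<close> Hankel determinants of the moments with index
  raised by one and of the moments themselves; up to sign, the monic orthogonal polynomial of degree
  \<open>n\<close> at 0. For \<open>n = 0\<close> the truncated subtractions give the right value
  \<open>1\<close>.\<close>

definition jacobi_shift :: "'a::field \<Rightarrow> 'a \<Rightarrow> 'a \<Rightarrow> nat \<Rightarrow> 'a"
  where "jacobi_shift Q c A n =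
    Q ^ (n choose 2) * qpoch A Q n * qpoch (A * c) Q (n - 1) / qpoch (A * c) Q (2 * n - 1)"

locale jacobi =
  fixes Q c :: "'a::field"
  assumes Q: "Q \<noteq> 0" and Q1: "\<And>k. Q * Q ^ k \<noteq> 1" and c1: "\<And>k. c * Q ^ k \<noteq> 1"
begin

text \<open>A predicate instead of a locale assumption, because the induction moves from
  \<open>A\<close> to \<open>A * Q\<close> and \<open>A * Q * Q\<close>.\<close>

definition admissible :: "'a \<Rightarrow> bool"
  where "admissible A \<longleftrightarrow> A \<noteq> 0 \<and> (\<forall>k. A * Q ^ k \<noteq> 1) \<and> (\<forall>k. A * c * Q ^ k \<noteq> 1)"

lemma admissible_mult: "admissible A \<Longrightarrow> admissible (A * Q)"
  unfolding admissible_def using Q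
  by (auto simp: mult.assoc mult.left_commute[of Q c] simp flip: power_Suc)

lemma admissibleD:
  assumes "admissible A"
  shows "A \<noteq> 0" "1 - A \<noteq> 0" "1 - A * c \<noteq> 0" "1 - A * Q ^ k \<noteq> 0" "1 - A * c * Q ^ k \<noteq> 0"
    "qpoch A Q k \<noteq> 0" "qpoch (A * c) Q k \<noteq> 0" "qpoch Q Q k \<noteq> 0" "qpoch c Q k \<noteq> 0"
proof -
  show "A \<noteq> 0" "1 - A * Q ^ k \<noteq> 0" "1 - A * c * Q ^ k \<noteq> 0" for k
    using assms by (auto simp: admissible_def)
  from this(2)[of 0] this(3)[of 0] show "1 - A \<noteq> 0" "1 - A * c \<noteq> 0" by auto
  show "qpoch A Q k \<noteq> 0" "qpoch (A * c) Q k \<noteq> 0" "qpoch Q Q k \<noteq> 0" "qpoch c Q k \<noteq> 0"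
    using assms Q1 c1 by (auto simp: admissible_def intro!: qpoch_nonzero)
qed

lemma qpoch_mult:
  assumes "admissible A"
  shows "qpoch (A * Q) Q n = qpoch A Q n * (1 - A * Q ^ n) / (1 - A)"
    and "qpoch (A * Q * c) Q n = qpoch (A * c) Q n * (1 - A * c * Q ^ n) / (1 - A * c)"
proof -
  show "qpoch (A * Q) Q n = qpoch A Q n * (1 - A * Q ^ n) / (1 - A)"
    using qpoch_Suc_shift[of A Q n] qpoch_Suc[of A Q n] admissibleD(2)[OF assms]
    by (simp add: field_simps)
  have "A * Q * c = A * c * Q" by simp
  then show "qpoch (A * Q * c) Q n = qpoch (A * c) Q n * (1 - A * c * Q ^ n) / (1 - A * c)"
    using qpoch_Suc_shift[of "A * c" Q n] qpoch_Suc[of "A * c" Q n] admissibleD(3)[OF assms]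
    by (simp add: field_simps)
qed

lemma jacobi_moment_Suc:
  assumes "admissible A"
  shows "jacobi_moment Q c A (Suc k) = (1 - A) / (1 - A * c) * jacobi_moment Q c (A * Q) k"
  unfolding jacobi_moment_def qpoch_mult[OF assms] qpoch_Suc
  using admissibleD[OF assms] by simp

lemma jacobi_norm_nonzero: "admissible A \<Longrightarrow> jacobi_norm Q c A k \<noteq> 0"
  using admissibleD[of A] Q by (simp add: jacobi_norm_def)

text \<open>For \<open>m = 0\<close> both subtractions are truncated and both sides are \<open>1\<close>.\<close>

lemma qpoch_pred_ratio:
  assumes "admissible A"
  shows "qpoch (A * Q * c) Q (m - 1) / qpoch (A * Q * c) Q (2 * m - 1) =
    qpoch (A * c) Q m / qpoch (A * c) Q (2 * m)"
proof (cases m)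
  case (Suc k)
  have "2 * Suc k - 1 = Suc (2 * k)" "2 * Suc k = Suc (Suc (2 * k))" by auto
  moreover have "A * Q * c = A * c * Q" by simp
  ultimately show ?thesis
    using Suc admissibleD(3)[OF assms] by (simp only: qpoch_Suc_shift[of "A * c"]) simp
qed simp

text \<open>Cross-multiplied quotient of the shift factors at \<open>A * Q\<close> and
  \<open>A\<close>. The two products in brackets become \<open>v\<close> and \<open>u\<close> in the
  induction for the determinant.\<close>

lemma jacobi_shift_mult:
  assumes A: "admissible A"
  shows "jacobi_shift Q c (A * Q) (Suc m) * ((1 - A) * (1 - A * c * Q ^ Suc (2 * m))) =
    jacobi_shift Q c A (Suc m) * ((1 - A * Q ^ Suc m) * (1 - A * c * Q ^ m))"
proof -
  have e: "2 * Suc m - 1 = Suc (2 * m)" "Suc m - 1 = m" by auto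
  show ?thesis
    unfolding jacobi_shift_def e qpoch_mult[OF A]
    using admissibleD[OF A] by (simp add: divide_simps del: power_Suc)
qed

text \<open>The telescoping step: an index shift multiplies the norm of index \<open>k\<close> by
  the quotient of consecutive values of \<open>jacobi_shift\<close>.\<close>

lemma jacobi_norm_shift:
  assumes A: "admissible A"
  shows "jacobi_norm Q c (A * Q) k * ((1 - A) / (1 - A * c)) * jacobi_shift Q c A k =
    jacobi_norm Q c A k * jacobi_shift Q c A (Suc k)"
proof (cases k)
  case 0
  then show ?thesis using admissibleD[OF A] by (simp add: jacobi_norm_def jacobi_shift_def qpoch_Suc numeral_2_eq_2)
next
  case (Suc m)
  define w1 w2 where "w1 = 1 - A * c * Q ^ Suc (2 * m)" and "w2 = 1 - A * c * Q ^ Suc (Suc (2 * m))"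
  define P0 P1 where "P0 = qpoch (A * c) Q m" and "P1 = qpoch (A * c) Q (Suc (2 * m))"
  have e: "2 * Suc m - 1 = Suc (2 * m)" "2 * Suc m = Suc (Suc (2 * m))"
    "Suc (Suc (2 * m)) - 1 = Suc (2 * m)"
    "2 * Suc (Suc m) - 1 = Suc (Suc (Suc (2 * m)))" "Suc m - 1 = m" "Suc (Suc m) - 1 = Suc m"
    "Suc (Suc m) choose 2 = (Suc m choose 2) + Suc m"
    by (auto simp: numeral_2_eq_2)
  have P: "qpoch (A * c) Q (Suc m) = P0 * (1 - A * c * Q ^ m)"
    "qpoch (A * c) Q (Suc (Suc (2 * m))) = P1 * w1"
    "qpoch (A * c) Q (Suc (Suc (Suc (2 * m)))) = P1 * w1 * w2"
    "qpoch A Q (Suc (Suc m)) = qpoch A Q (Suc m) * (1 - A * Q ^ Suc m)"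
    by (simp_all add: P0_def P1_def w1_def w2_def qpoch_Suc)
  have nz: "w1 \<noteq> 0" "w2 \<noteq> 0" "P1 \<noteq> 0"
    using admissibleD[OF A] by (simp_all add: w1_def w2_def P1_def del: power_Suc)
  show ?thesis
    unfolding Suc jacobi_norm_def jacobi_shift_def e qpoch_mult[OF A] power_mult_distrib
    unfolding P w1_def[symmetric] w2_def[symmetric] P0_def[symmetric] P1_def[symmetric] power_add
    using admissibleD(2,3)[OF A] nz
    by (simp add: divide_simps del: power_Suc)
qed

text \<open>Two index shifts lower the norm index by one. The last bracket on the right is the
  difference of the two brackets in \<open>jacobi_shift_mult\<close>, which is what condensation
  produces.\<close>

lemma jacobi_norm_Suc:
  assumes A: "admissible A"
  shows "jacobi_norm Q c A (Suc m) * ((1 - A * Q ^ Suc m) * (1 - A * c * Q ^ m)) =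
    jacobi_norm Q c (A * Q * Q) m * jacobi_moment Q c A 2 *
      (A * (1 - Q * Q ^ m) * (1 - c * Q ^ m))"
proof -
  note A' = admissible_mult[OF A]
  define w0 w1 where "w0 = 1 - A * c * Q ^ (2 * m)" and "w1 = 1 - A * c * Q ^ Suc (2 * m)"
  define P0 P2 where "P0 = qpoch (A * c) Q m" and "P2 = qpoch (A * c) Q (2 * m)"
  have e: "2 * Suc m - 1 = Suc (2 * m)" "2 * Suc m = Suc (Suc (2 * m))" "Suc m - 1 = m"
    "Suc (Suc (2 * m)) - 1 = Suc (2 * m)" by auto
  have e': "Suc m * m = m + m + m * (m - 1)" by (cases m) auto
  have P: "qpoch (A * c) Q (Suc m) = P0 * (1 - A * c * Q ^ m)"
    "qpoch (A * c) Q (Suc (2 * m)) = P2 * w0"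
    "qpoch (A * c) Q (Suc (Suc (2 * m))) = P2 * w0 * w1"
    by (simp_all add: P0_def P2_def w0_def w1_def qpoch_Suc)
  have AQc: "A * Q * c * Q ^ m = A * c * Q ^ Suc m" "A * Q * Q ^ m = A * Q ^ Suc m" for m by simp_all
  have nz: "w0 \<noteq> 0" "w1 \<noteq> 0" "P2 \<noteq> 0" "1 - A * Q \<noteq> 0" "1 - A * Q * c \<noteq> 0"
    using admissibleD[OF A] admissibleD(2,3)[OF A'] by (simp_all add: w0_def w1_def P2_def del: power_Suc)
  have moment: "jacobi_moment Q c A 2 = (1 - A) / (1 - A * c) * ((1 - A * Q) / (1 - A * Q * c))"
    by (simp add: numeral_2_eq_2 jacobi_moment_Suc[OF A] jacobi_moment_Suc[OF A'])
      (simp add: jacobi_moment_def)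
  \<comment> \<open>The symbols with truncated subtraction are grouped as one quotient, so that
    \<open>qpoch_pred_ratio\<close> treats \<open>m = 0\<close> along with the other cases.\<close>
  have "jacobi_norm Q c (A * Q * Q) m = A ^ m * Q ^ m * Q ^ m * Q ^ (m * (m - 1)) *
      qpoch (A * Q * Q) Q m * qpoch Q Q m * qpoch c Q m *
      (qpoch (A * Q * Q * c) Q (m - 1) / qpoch (A * Q * Q * c) Q (2 * m - 1)) /
      qpoch (A * Q * Q * c) Q (2 * m)"
    by (simp add: jacobi_norm_def power_mult_distrib)
  also have "\<dots> = A ^ m * Q ^ (Suc m * m) * (qpoch A Q m * (1 - A * Q ^ m) / (1 - A) *
      (1 - A * Q ^ Suc m) / (1 - A * Q)) * qpoch Q Q m * qpoch c Q m *
      (P0 * (1 - A * c * Q ^ m) / (P2 * w0)) /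
      (P2 * w0 / (1 - A * c) * w1 / (1 - A * Q * c))"
    unfolding qpoch_pred_ratio[OF A'] unfolding qpoch_mult[OF A'] qpoch_mult[OF A] AQc
    unfolding P0_def[symmetric] P2_def[symmetric] w0_def[symmetric] w1_def[symmetric] e' power_add
    using nz admissibleD(2,3)[OF A] by (simp add: divide_simps del: power_Suc)
  finally have norm: "jacobi_norm Q c (A * Q * Q) m = \<dots>" .
  show ?thesis
    unfolding norm moment unfolding jacobi_norm_def e P qpoch_Suc[of A] qpoch_Suc[of Q] qpoch_Suc[of c]
      P0_def[symmetric]
    using nz admissibleD(2,3)[OF A] by (simp add: divide_simps del: power_Suc) (simp only: power_Suc[of A] mult_ac simp_thms)
qed

text \<open>Two-step induction for all admissible \<open>A\<close> at once: condensation expresses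
  order \<open>N + 2\<close> at \<open>A\<close> through smaller orders at \<open>A\<close>,
  \<open>A * Q\<close> and \<open>A * Q * Q\<close>.\<close>

lemma hankel_minor_jacobi_moment:
  assumes "admissible A"
  shows "hankel_minor (jacobi_moment Q c A) N = (\<Prod>k<N. jacobi_norm Q c A k)"
  using assms
proof (induction N arbitrary: A rule: induct_nat_012)
  case 0
  show ?case by simp
next
  case 1
  show ?case by (simp add: jacobi_moment_def jacobi_norm_def)
next
  case (ge2 N)
  note A = ge2.prems
  note A' = admissible_mult[OF A]
  note A'' = admissible_mult[OF A']
  let ?M = "jacobi_moment Q c" and ?h = "\<lambda>A N. \<Prod>k<N. jacobi_norm Q c A k"
  let ?R = "jacobi_shift Q c" and ?a = "\<lambda>A. (1 - A) / (1 - A * c)"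
  have scale: "hankel_minor (\<lambda>k. a * s k) n = a ^ n * hankel_minor s n" for a :: 'a and s n
    using hankel_minor_scale[of a 1 s n] by simp
  \<comment> \<open>The quotient of the two products of norms telescopes by
    \<open>jacobi_norm_shift\<close>.\<close>
  have ratio: "?a A ^ n * ?h (A * Q) n = ?h A n * ?R A n" if A: "admissible A" for A n
  proof (induction n)
    case 0
    show ?case by (simp add: jacobi_shift_def numeral_2_eq_2)
  next
    case (Suc n)
    have nz: "?R A n \<noteq> 0"
      using admissibleD[OF A] Q by (simp add: jacobi_shift_def)
    have "?a A ^ Suc n * ?h (A * Q) (Suc n) * ?R A n =
        (?a A ^ n * ?h (A * Q) n) * (jacobi_norm Q c (A * Q) n * ?a A * ?R A n)"
      by (simp only: prod.lessThan_Suc power_Suc mult_ac)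
    also have "\<dots> = ?h A (Suc n) * ?R A (Suc n) * ?R A n"
      unfolding Suc jacobi_norm_shift[OF A] by (simp only: prod.lessThan_Suc mult_ac)
    finally show ?case
      using nz by (simp only: mult_cancel_right simp_thms)
  qed
  define X where "X = ?h A (Suc N)"
  \<comment> \<open>\<open>W\<close> is the determinant by which condensation divides.\<close>
  define W where "W = ?M A 2 ^ N * ?h (A * Q * Q) N"
  have M2: "?M A (k + 2) = ?M A 2 * ?M (A * Q * Q) k" for k
    by (simp add: numeral_2_eq_2 jacobi_moment_Suc[OF A] jacobi_moment_Suc[OF A'])
      (simp add: jacobi_moment_def)
  have a2: "?M A 2 = ?a A * ?a (A * Q)"
    by (simp add: numeral_2_eq_2 jacobi_moment_Suc[OF A] jacobi_moment_Suc[OF A'])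
      (simp add: jacobi_moment_def)
  have "?M A 2 \<noteq> 0"
    using admissibleD(6,7)[OF A] by (simp add: jacobi_moment_def)
  then have W: "W \<noteq> 0"
    using jacobi_norm_nonzero[OF A''] by (simp add: W_def)
  have i1: "hankel_minor (?M A) (N + 1) = X"
    using ge2.IH(2)[OF A] by (simp add: X_def)
  have i2: "hankel_minor (\<lambda>k. ?M A (k + 2)) N = W"
    unfolding M2 scale using ge2.IH(1)[OF A''] by (simp add: W_def)
  have i3: "hankel_minor (\<lambda>k. ?M A (k + 1)) (N + 1) = X * ?R A (Suc N)"
    unfolding Suc_eq_plus1[symmetric] jacobi_moment_Suc[OF A] scale ge2.IH(2)[OF A'] X_def
    by (rule ratio[OF A])
  have i4: "hankel_minor (\<lambda>k. ?M A (k + 2)) (N + 1) = W * (?M A 2 * jacobi_norm Q c (A * Q * Q) N)"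
    unfolding M2 scale using ge2.IH(2)[OF A''] by (simp add: W_def)
  \<comment> \<open>Applying \<open>ratio\<close> twice, at \<open>A * Q\<close> and at
    \<open>A\<close>, expresses the doubly shifted determinant through \<open>X\<close>.\<close>
  have "W * (?M A 2 * jacobi_norm Q c (A * Q * Q) N) =
      ?a A ^ Suc N * (?a (A * Q) ^ Suc N * ?h (A * Q * Q) (Suc N))"
    unfolding W_def a2 power_mult_distrib power_Suc prod.lessThan_Suc by (simp only: mult_ac)
  also have "\<dots> = X * ?R A (Suc N) * ?R (A * Q) (Suc N)"
    unfolding ratio[OF A'] using ratio[OF A, of "Suc N"] by (simp only: X_def mult.assoc[symmetric])
  finally have i5: "W * (?M A 2 * jacobi_norm Q c (A * Q * Q) N) =
      X * ?R A (Suc N) * ?R (A * Q) (Suc N)" .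
  \<comment> \<open>The scalar identity that remains of condensation once the common determinants
    are taken out.\<close>
  have key: "jacobi_norm Q c A (Suc N) * ?R (A * Q) (Suc N) =
      ?M A 2 * jacobi_norm Q c (A * Q * Q) N * (?R (A * Q) (Suc N) - ?R A (Suc N))"
  proof -
    define u v where "u = (1 - A * Q ^ Suc N) * (1 - A * c * Q ^ N)"
      and "v = (1 - A) * (1 - A * c * Q ^ Suc (2 * N))"
    have uv: "u \<noteq> 0" "v \<noteq> 0"
      using admissibleD[OF A] by (simp_all add: u_def v_def del: power_Suc)
    have "u - v = A * (1 - Q * Q ^ N) * (1 - c * Q ^ N)"
      by (simp add: u_def v_def algebra_simps power_mult_distrib power2_eq_square power_mult mult.commute[of 2])
    then have norm: "jacobi_norm Q c A (Suc N) * u = jacobi_norm Q c (A * Q * Q) N * ?M A 2 * (u - v)"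
      using jacobi_norm_Suc[OF A, of N] by (simp add: u_def)
    have shift: "?R (A * Q) (Suc N) * v = ?R A (Suc N) * u"
      using jacobi_shift_mult[OF A, of N] by (simp only: u_def v_def)
    have "u * (jacobi_norm Q c A (Suc N) * ?R (A * Q) (Suc N)) =
        jacobi_norm Q c A (Suc N) * u * ?R (A * Q) (Suc N)"
      by (simp only: mult_ac)
    also have "\<dots> = jacobi_norm Q c (A * Q * Q) N * ?M A 2 *
        (u * ?R (A * Q) (Suc N) - ?R (A * Q) (Suc N) * v)"
      unfolding norm by (simp add: algebra_simps)
    also have "\<dots> = u * (?M A 2 * jacobi_norm Q c (A * Q * Q) N *
        (?R (A * Q) (Suc N) - ?R A (Suc N)))"
      unfolding shift by (simp add: algebra_simps)
    finally have "u * (jacobi_norm Q c A (Suc N) * ?R (A * Q) (Suc N)) = \<dots>" .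
    then show ?thesis using uv by simp
  qed
  let ?H = "hankel_minor (?M A) (N + 2)"
  \<comment> \<open>The extra factor \<open>?R (A * Q) (Suc N)\<close> brings the right-hand side
    into the shape of \<open>key\<close>; it is cancelled together with \<open>W\<close> at the
    end.\<close>
  have "?H * W * ?R (A * Q) (Suc N) = (X * (X * ?R A (Suc N) * ?R (A * Q) (Suc N)) -
      (X * ?R A (Suc N)) ^ 2) * ?R (A * Q) (Suc N)"
    using hankel_minor_condensation[of "?M A" N] unfolding i1 i2 i3 i4 i5 by simp
  also have "\<dots> = X * (X * ?R A (Suc N) * ?R (A * Q) (Suc N) * (?R (A * Q) (Suc N) - ?R A (Suc N)))"
    by (simp add: algebra_simps power2_eq_square)
  also have "\<dots> = X * W * (?M A 2 * jacobi_norm Q c (A * Q * Q) N * (?R (A * Q) (Suc N) - ?R A (Suc N)))"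
    unfolding i5[symmetric] by (simp only: mult_ac)
  also have "\<dots> = X * jacobi_norm Q c A (Suc N) * W * ?R (A * Q) (Suc N)"
    unfolding key[symmetric] by (simp only: mult_ac)
  finally have "?H = X * jacobi_norm Q c A (Suc N)"
    using W admissibleD[OF A'] Q by (simp add: jacobi_shift_def)
  then show ?case by (simp add: X_def mult_ac)
qed

end

section \<open>Carlitz's q-Euler numbers\<close>

lemma q_nonzero: "q \<noteq> 0"
  by (simp add: q_def)

lemma one_minus_q_power_nonzero:
  assumes "m > 0"
  shows "1 - q ^ m \<noteq> 0"
proof -
  have "poly (1 - monom (1::rat) m) 0 = 1" using assms by (simp add: poly_monom)
  then have "1 - monom (1::rat) m \<noteq> 0" by force
  then have "to_fract (1 - monom (1::rat) m) \<noteq> 0" by (simp only: to_fract_eq_0_iff not_False_eq_True)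
  then show ?thesis by (simp add: q_power)
qed

lemma q_power_neq: "q * q ^ k \<noteq> 1" "q ^ 2 * q ^ k \<noteq> 1" "- (q ^ m) \<noteq> 1"
  using one_minus_q_power_nonzero[of "Suc k"] one_minus_q_power_nonzero[of "k + 2"]
    one_plus_q_power_nonzero[of m]
  by (auto simp: power2_eq_square mult.assoc eq_neg_iff_add_eq_0 minus_equation_iff[of _ 1])

interpretation jacobi1: jacobi q q
  by unfold_locales (simp_all add: q_nonzero q_power_neq)

interpretation jacobi2: jacobi q "q ^ 2"
  by unfold_locales (simp_all add: q_nonzero q_power_neq)

lemma admissible_q: "jacobi1.admissible (- q)" "jacobi2.admissible (- q)"
  unfolding jacobi1.admissible_def jacobi2.admissible_def
  using q_nonzero q_power_neq(3)[of "Suc _"] q_power_neq(3)[of "Suc (Suc _)"]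
    q_power_neq(3)[of "Suc (Suc (Suc _))"]
  by (auto simp: power2_eq_square mult.assoc)

section \<open>Norms and moments for the two parameter choices, in base \<open>q ^ 2\<close>\<close>

definition norm0 :: "nat \<Rightarrow> rat poly fract"
  where "norm0 k = qpochs [q ^ 2, q ^ 2] (q ^ 2) k / qpochs [- q, - (q ^ 2), - (q ^ 2), - (q ^ 3)] (q ^ 2) k"

definition norm1 :: "nat \<Rightarrow> rat poly fract"
  where "norm1 k = qpochs [q ^ 2, q ^ 4] (q ^ 2) k /
    qpochs [- (q ^ 2), - (q ^ 3), - (q ^ 3), - (q ^ 4)] (q ^ 2) k"

text \<open>Unlike \<open>norm0\<close> and \<open>norm1\<close>, this is not tied to a
  \<open>jacobi_norm\<close>; it enters through its relation to the other two.\<close>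

definition norm2 :: "nat \<Rightarrow> rat poly fract"
  where "norm2 k = qpochs [q ^ 4, q ^ 4] (q ^ 2) k /
    qpochs [- (q ^ 3), - (q ^ 4), - (q ^ 4), - (q ^ 5)] (q ^ 2) k"

lemma qpoch_uminus_q_power: "qpoch (- (q ^ a)) (q ^ b) k \<noteq> 0"
proof (rule qpoch_nonzero)
  fix j
  show "- (q ^ a) * (q ^ b) ^ j \<noteq> 1"
    using q_power_neq(3)[of "a + b * j"] by (simp add: power_add power_mult)
qed

lemma qpoch_q_power:
  assumes "a > 0"
  shows "qpoch (q ^ a) (q ^ b) k \<noteq> 0"
proof (rule qpoch_nonzero)
  fix j
  show "q ^ a * (q ^ b) ^ j \<noteq> 1"
    using one_minus_q_power_nonzero[of "a + b * j"] assms by (auto simp: power_add power_mult)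
qed

text \<open>Regrouping the factors of even and odd index turns base \<open>q\<close> into base \<open>q\<^sup>2\<close>.\<close>

lemma qpoch_double:
  "qpoch (- (q ^ a)) q (2 * k) = qpoch (- (q ^ a)) (q ^ 2) k * qpoch (- (q ^ Suc a)) (q ^ 2) k"
  by (induction k) (simp_all add: qpoch_Suc power_mult[symmetric] algebra_simps)

text \<open>Each factor is a difference of squares.\<close>

lemma qpoch_square: "qpoch (x ^ 2) (q ^ 2) k = qpoch x q k * qpoch (- x) q k"
  by (induction k)
    (simp_all add: qpoch_Suc algebra_simps power_mult[symmetric] power_add power2_eq_square power_mult_distrib mult_2)

text \<open>The symbols of lengths \<open>k - 1\<close> and \<open>2 * k - 1\<close> lack only the
  first factor \<open>1 + q\<close> of symbols of \<open>- q\<close> with lengths \<open>k\<close>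
  and \<open>2 * k\<close>. Completing them costs \<open>1 + q\<close> in numerator and denominator
  alike; then everything regroups in base \<open>q ^ 2\<close>.\<close>

lemma jacobi_norm_q: "jacobi_norm q q (- q) k = (-1) ^ k * q ^ (k ^ 2) * norm0 k"
proof (cases k)
  case 0
  then show ?thesis by (simp add: jacobi_norm_def norm0_def qpochs_def)
next
  case (Suc m)
  have k: "2 * k - 1 = Suc (2 * m)" "2 * k = Suc (Suc (2 * m))" "k - 1 = m" using Suc by auto
  have "(1 + q) * qpoch (- (q ^ 2)) q m = qpoch (- q) q k"
    unfolding Suc qpoch_Suc_shift[of "- q"] by (simp add: power2_eq_square)
  then have 1: "qpoch (- (q ^ 2)) q (k - 1) = qpoch (- q) q k / (1 + q)"
    using one_plus_q_power_nonzero[of 1] unfolding k(3) by (simp add: field_simps)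
  have "(1 + q) * qpoch (- (q ^ 2)) q (Suc (2 * m)) = qpoch (- q) q (2 * k)"
    unfolding k qpoch_Suc_shift[of "- q"] by (simp add: power2_eq_square)
  then have 2: "qpoch (- (q ^ 2)) q (2 * k - 1) = qpoch (- q) q (2 * k) / (1 + q)"
    using one_plus_q_power_nonzero[of 1] unfolding k(1) by (simp add: field_simps)
  have e: "- q * q = - (q ^ 2)" by (simp add: power2_eq_square)
  have "k ^ 2 = k + k * (k - 1)" by (cases k) (auto simp: power2_eq_square)
  then have 3: "(- q) ^ k * q ^ (k * (k - 1)) = (-1) ^ k * q ^ (k ^ 2)"
    by (simp add: power_add power_minus[of q])
  show ?thesis
    unfolding jacobi_norm_def e 1 2 3 norm0_def qpochs_def
    using qpoch_double[of 1 k] qpoch_double[of 2 k] qpoch_square[of q k] one_plus_q_power_nonzero[of 1]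
    by (simp add: power2_eq_square eval_nat_numeral mult_ac)
qed

text \<open>As for \<open>c = q\<close>, with \<open>1 + q ^ 2\<close> as the missing first
  factor.\<close>

lemma jacobi_norm_q2: "jacobi_norm q (q ^ 2) (- q) k = (-1) ^ k * q ^ (k ^ 2) * norm1 k"
proof (cases k)
  case 0
  then show ?thesis by (simp add: jacobi_norm_def norm1_def qpochs_def)
next
  case (Suc m)
  have k: "2 * k - 1 = Suc (2 * m)" "2 * k = Suc (Suc (2 * m))" "k - 1 = m" using Suc by auto
  have "(1 + q ^ 2) * qpoch (- (q ^ 3)) q m = qpoch (- (q ^ 2)) q k"
    unfolding Suc qpoch_Suc_shift[of "- (q ^ 2)"] by (simp add: eval_nat_numeral mult_ac)
  then have 1: "qpoch (- (q ^ 3)) q (k - 1) = qpoch (- (q ^ 2)) q k / (1 + q ^ 2)"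
    using one_plus_q_power_nonzero[of 2] unfolding k(3) by (simp add: field_simps)
  have "(1 + q ^ 2) * qpoch (- (q ^ 3)) q (Suc (2 * m)) = qpoch (- (q ^ 2)) q (2 * k)"
    unfolding k qpoch_Suc_shift[of "- (q ^ 2)"] by (simp add: eval_nat_numeral mult_ac)
  then have 2: "qpoch (- (q ^ 3)) q (2 * k - 1) = qpoch (- (q ^ 2)) q (2 * k) / (1 + q ^ 2)"
    using one_plus_q_power_nonzero[of 2] unfolding k(1) by (simp add: field_simps)
  have e: "- q * q ^ 2 = - (q ^ 3)" by (simp add: eval_nat_numeral)
  have "k ^ 2 = k + k * (k - 1)" by (cases k) (auto simp: power2_eq_square)
  then have 3: "(- q) ^ k * q ^ (k * (k - 1)) = (-1) ^ k * q ^ (k ^ 2)"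
    by (simp add: power_add power_minus[of q])
  have 4: "qpoch (q ^ 4) (q ^ 2) k = qpoch (q ^ 2) q k * qpoch (- (q ^ 2)) q k"
    using qpoch_square[of "q ^ 2" k] by (simp flip: power_mult)
  show ?thesis
    unfolding jacobi_norm_def e 1 2 3 norm1_def qpochs_def
    using qpoch_double[of 2 k] qpoch_double[of 3 k] qpoch_square[of q k] 4 one_plus_q_power_nonzero[of 2]
    by (simp add: eval_nat_numeral mult_ac)
qed

lemma jacobi_moment_q: "jacobi_moment q q (- q) k = (1 + q) / (1 + q ^ (k + 1))"
proof -
  have "qpoch (- q) q (Suc k) = (1 + q) * qpoch (- q * q) q k"
    by (simp add: qpoch_Suc_shift)
  then have "qpoch (- q) q k * (1 + q ^ (k + 1)) = (1 + q) * qpoch (- q * q) q k"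
    by (simp add: qpoch_Suc)
  then show ?thesis
    using qpoch_uminus_q_power[of 2 1 k] one_plus_q_power_nonzero[of "k + 1"]
    by (simp add: jacobi_moment_def divide_simps power2_eq_square mult_ac)
qed

lemma jacobi_moment_q2:
  "jacobi_moment q (q ^ 2) (- q) k = (1 + q) * (1 + q ^ 2) / ((1 + q ^ (k + 1)) * (1 + q ^ (k + 2)))"
proof -
  have "qpoch (- q) q (Suc (Suc k)) = (1 + q) * (1 + q ^ 2) * qpoch (- q * q ^ 2) q k"
    by (simp add: qpoch_Suc_shift power2_eq_square mult_ac)
  then have "qpoch (- q) q k * ((1 + q ^ (k + 1)) * (1 + q ^ (k + 2))) =
      (1 + q) * (1 + q ^ 2) * qpoch (- q * q ^ 2) q k"
    by (simp add: qpoch_Suc mult_ac)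
  then show ?thesis
    using qpoch_uminus_q_power[of 3 1 k] one_plus_q_power_nonzero[of "k + 1"]
      one_plus_q_power_nonzero[of "k + 2"]
    by (simp add: jacobi_moment_def divide_simps power2_eq_square power3_eq_cube mult_ac del: power_Suc)
qed

section \<open>The q-Euler numbers as binomial transforms, and the first two determinants\<close>

lemma qEuler_conv_binom_transform:
  "qEuler n = (1 / (1 - q)) ^ n * binom_transform (jacobi_moment q q (- q)) n"
  unfolding qEuler_def binom_transform_def jacobi_moment_q by (simp add: power_one_over)

text \<open>Differencing the moments for \<open>c = q\<close> gives those for
  \<open>c = q ^ 2\<close> times a constant and \<open>q ^ k\<close>; the factor
  \<open>1 - q\<close> of that constant cancels one power of the denominator. The \<open>1 *\<close>
  keeps the sequence in the form that \<open>hankel_minor_scale\<close> rewrites.\<close>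

lemma qEuler_Suc_conv_binom_transform:
  "qEuler (n + 1) = - q / (1 + q ^ 2) * (1 / (1 - q)) ^ n *
    binom_transform (\<lambda>k. 1 * q ^ k * jacobi_moment q (q ^ 2) (- q) k) n"
proof -
  have diff: "jacobi_moment q q (- q) k - jacobi_moment q q (- q) (Suc k) =
      - q * (1 - q) / (1 + q ^ 2) * (1 * q ^ k * jacobi_moment q (q ^ 2) (- q) k)" for k
  proof -
    define a b d where "a = 1 + q ^ Suc k" and "b = 1 + q ^ Suc (Suc k)" and "d = 1 + q ^ 2"
    have nz: "a \<noteq> 0" "b \<noteq> 0" "d \<noteq> 0"
      unfolding a_def b_def d_def by (rule one_plus_q_power_nonzero)+
    have "b - a = - q * (1 - q) * q ^ k"
      by (simp add: a_def b_def algebra_simps)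
    have "(1 + q) / a - (1 + q) / b = (1 + q) * (b - a) / (a * b)"
      using nz by (simp add: field_simps)
    also have "\<dots> = - q * (1 - q) / d * (1 * q ^ k * ((1 + q) * d / (a * b)))"
      unfolding \<open>b - a = _\<close> using nz by (simp add: field_simps)
    finally show ?thesis
      unfolding jacobi_moment_q jacobi_moment_q2 by (simp add: a_def b_def d_def)
  qed
  have lin: "binom_transform (\<lambda>k. x * f k) n = x * binom_transform f n"
    for x and f :: "nat \<Rightarrow> rat poly fract"
    by (simp add: binom_transform_def sum_distrib_left mult_ac)
  let ?B = "binom_transform (\<lambda>k. 1 * q ^ k * jacobi_moment q (q ^ 2) (- q) k) n"
  have "qEuler (n + 1) = (1 / (1 - q)) ^ Suc n * (- q * (1 - q) / (1 + q ^ 2) * ?B)"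
    unfolding qEuler_conv_binom_transform Suc_eq_plus1[symmetric] binom_transform_Suc diff lin ..
  also have "\<dots> = - q / (1 + q ^ 2) * ((1 - q) * (1 / (1 - q)) ^ Suc n) * ?B"
    by (simp add: mult_ac del: power_Suc)
  also have "(1 - q) * (1 / (1 - q)) ^ Suc n = (1 / (1 - q)) ^ n"
    using one_minus_q_nonzero by simp
  finally show ?thesis .
qed

lemma hankel_minor_qEuler:
  "hankel_minor qEuler N = (\<Prod>k<N. (-1) ^ k * q ^ (k ^ 2) * norm0 k) / (1 - q) ^ (N * (N - 1))"
proof -
  have "hankel_minor qEuler N =
      hankel_minor (\<lambda>n. 1 * (1 / (1 - q)) ^ n * binom_transform (jacobi_moment q q (- q)) n) N"
    by (simp add: qEuler_conv_binom_transform[abs_def])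
  also have "\<dots> = (1 / (1 - q)) ^ (N * (N - 1)) * hankel_minor (jacobi_moment q q (- q)) N"
    unfolding hankel_minor_scale hankel_minor_binom_transform by simp
  finally show ?thesis
    by (simp add: jacobi1.hankel_minor_jacobi_moment[OF admissible_q(1)] jacobi_norm_q power_one_over)
qed

lemma hankel_minor_qEuler_Suc:
  "hankel_minor (\<lambda>n. qEuler (n + 1)) N = (- q / (1 + q ^ 2)) ^ N * q ^ (N * (N - 1)) *
    (\<Prod>k<N. (-1) ^ k * q ^ (k ^ 2) * norm1 k) / (1 - q) ^ (N * (N - 1))"
  unfolding qEuler_Suc_conv_binom_transform hankel_minor_scale hankel_minor_binom_transform
    jacobi2.hankel_minor_jacobi_moment[OF admissible_q(2)] jacobi_norm_q2
  by (simp add: power_one_over)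

section \<open>Relations between the three sequences of factors, and the third determinant\<close>

lemma norm_nonzero: "norm0 k \<noteq> 0" "norm1 k \<noteq> 0"
  using qpoch_uminus_q_power[of 1 2 k]
  by (simp_all add: norm0_def norm1_def qpochs_def qpoch_uminus_q_power qpoch_q_power)

lemma qpoch_q_power_Suc:
  "qpoch (q ^ a) (q ^ 2) (Suc k) = qpoch (q ^ a) (q ^ 2) k * (1 - q ^ (2 * k + a))"
  "qpoch (- (q ^ a)) (q ^ 2) (Suc k) = qpoch (- (q ^ a)) (q ^ 2) k * (1 + q ^ (2 * k + a))"
  "qpoch (- q) (q ^ 2) (Suc k) = qpoch (- q) (q ^ 2) k * (1 + q ^ (2 * k + 1))"
  by (simp_all add: qpoch_Suc power_add mult.commute flip: power_mult)

lemma norm0_Suc: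
  "norm0 (Suc k) = norm0 k * ((1 - q ^ (2 * k + 2)) ^ 2 /
    ((1 + q ^ (2 * k + 1)) * (1 + q ^ (2 * k + 2)) ^ 2 * (1 + q ^ (2 * k + 3))))"
  by (simp only: norm0_def qpochs_def list.map prod_list.Cons prod_list.Nil qpoch_q_power_Suc
      mult_1_right power2_eq_square[of "1 - q ^ i" for i] power2_eq_square[of "1 + q ^ i" for i] times_divide_times_eq mult_ac)

lemma norm1_Suc:
  "norm1 (Suc k) = norm1 k * ((1 - q ^ (2 * k + 2)) * (1 - q ^ (2 * k + 4)) /
    ((1 + q ^ (2 * k + 2)) * (1 + q ^ (2 * k + 3)) ^ 2 * (1 + q ^ (2 * k + 4))))"
  by (simp only: norm1_def qpochs_def list.map prod_list.Cons prod_list.Nil qpoch_q_power_Suc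
      mult_1_right power2_eq_square[of "1 - q ^ i" for i] power2_eq_square[of "1 + q ^ i" for i] times_divide_times_eq mult_ac)

lemma norm2_Suc:
  "norm2 (Suc k) = norm2 k * ((1 - q ^ (2 * k + 4)) ^ 2 /
    ((1 + q ^ (2 * k + 3)) * (1 + q ^ (2 * k + 4)) ^ 2 * (1 + q ^ (2 * k + 5))))"
  by (simp only: norm2_def qpochs_def list.map prod_list.Cons prod_list.Nil qpoch_q_power_Suc
      mult_1_right power2_eq_square[of "1 - q ^ i" for i] power2_eq_square[of "1 + q ^ i" for i] times_divide_times_eq mult_ac)

text \<open>In the quotient of \<open>norm1 k\<close> and \<open>norm0 k\<close> the parameters
  differ by steps of \<open>q ^ 2\<close>, so the symbols telescope. Denominators are
  cleared.\<close>

lemma norm1_norm0: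
  "norm1 k * ((1 - q ^ 2) * (1 + q ^ (2 * k + 1)) * (1 + q ^ (2 * k + 2))) =
    norm0 k * ((1 - q ^ (2 * k + 2)) * (1 + q) * (1 + q ^ 2))"
proof (induction k)
  case 0
  show ?case by (simp add: norm0_def norm1_def qpochs_def power2_eq_square mult_ac)
next
  case (Suc k)
  define a b c d e f where "a = 1 + q ^ (2 * k + 1)" and "b = 1 + q ^ (2 * k + 2)"
    and "c = 1 + q ^ (2 * k + 3)" and "d = 1 + q ^ (2 * k + 4)" and "e = 1 - q ^ (2 * k + 2)"
    and "f = 1 - q ^ (2 * k + 4)"
  have nz: "a \<noteq> 0" "b \<noteq> 0" "c \<noteq> 0" "d \<noteq> 0"
    unfolding a_def b_def c_def d_def by (rule one_plus_q_power_nonzero)+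
  have e: "2 * Suc k + 1 = 2 * k + 3" "2 * Suc k + 2 = 2 * k + 4" by auto
  have IH: "norm1 k * ((1 - q ^ 2) * a * b) = norm0 k * (e * (1 + q) * (1 + q ^ 2))"
    using Suc by (simp only: a_def b_def e_def)
  have "norm1 k * (e * f / (b * c ^ 2 * d)) * ((1 - q ^ 2) * c * d) =
      norm1 k * ((1 - q ^ 2) * a * b) * (e * f / (a * b ^ 2 * c))"
    using nz by (simp add: divide_simps power2_eq_square)
  also have "\<dots> = norm0 k * (e ^ 2 / (a * b ^ 2 * c)) * (f * (1 + q) * (1 + q ^ 2))"
    unfolding IH using nz by (simp add: divide_simps power2_eq_square)
  finally show ?case
    unfolding norm0_Suc norm1_Suc e by (simp only: a_def b_def c_def d_def e_def f_def)
qed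

text \<open>The numerators of \<open>norm2 k * norm0 k\<close> and \<open>norm1 k ^ 2\<close> agree;
  below, only the symbols of \<open>- q\<close>, \<open>- (q ^ 3)\<close> and
  \<open>- (q ^ 5)\<close> survive, and they telescope.\<close>

lemma norm0_norm2:
  "norm2 k * norm0 k * ((1 + q) * (1 + q ^ (2 * k + 3))) =
    norm1 k ^ 2 * ((1 + q ^ 3) * (1 + q ^ (2 * k + 1)))"
proof (induction k)
  case 0
  show ?case by (simp add: norm0_def norm1_def norm2_def qpochs_def)
next
  case (Suc k)
  define a b c d e f g where "a = 1 + q ^ (2 * k + 1)" and "b = 1 + q ^ (2 * k + 2)"
    and "c = 1 + q ^ (2 * k + 3)" and "d = 1 + q ^ (2 * k + 4)" and "e = 1 - q ^ (2 * k + 2)"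
    and "f = 1 - q ^ (2 * k + 4)" and "g = 1 + q ^ (2 * k + 5)"
  have nz: "a \<noteq> 0" "b \<noteq> 0" "c \<noteq> 0" "d \<noteq> 0" "g \<noteq> 0"
    unfolding a_def b_def c_def d_def g_def by (rule one_plus_q_power_nonzero)+
  have e: "2 * Suc k + 1 = 2 * k + 3" "2 * Suc k + 3 = 2 * k + 5" by auto
  have IH: "norm2 k * norm0 k * ((1 + q) * c) = norm1 k ^ 2 * ((1 + q ^ 3) * a)"
    using Suc by (simp only: a_def c_def)
  have "norm2 k * (f ^ 2 / (c * d ^ 2 * g)) * (norm0 k * (e ^ 2 / (a * b ^ 2 * c))) * ((1 + q) * g) =
      norm2 k * norm0 k * ((1 + q) * c) * (f ^ 2 * e ^ 2 / (a * b ^ 2 * c ^ 3 * d ^ 2))"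
    using nz by (simp add: divide_simps power2_eq_square power3_eq_cube)
  also have "\<dots> = (norm1 k * (e * f / (b * c ^ 2 * d))) ^ 2 * ((1 + q ^ 3) * c)"
    unfolding IH using nz by (simp add: divide_simps power2_eq_square power3_eq_cube)
  finally show ?case
    unfolding norm0_Suc norm1_Suc norm2_Suc e
    by (simp only: a_def b_def c_def d_def e_def f_def g_def)
qed

text \<open>Condensation is a first-order recurrence in \<open>N\<close> for the left-hand side, which the first two
  determinants turn into a telescoping sum.\<close>

lemma hankel_minor_qEuler_Suc_Suc:
  "hankel_minor (\<lambda>n. qEuler (n + 2)) N * hankel_minor qEuler N * (q ^ (N ^ 2) * (1 + q ^ (2 * N + 1))) =
    hankel_minor (\<lambda>n. qEuler (n + 1)) N ^ 2 * ((-1) ^ N + q ^ ((N + 1) ^ 2))"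
proof (induction N)
  case 0
  show ?case by simp
next
  case (Suc N)
  let ?S = "\<lambda>r. hankel_minor (\<lambda>n. qEuler (n + r))"
  define t where "t = (1 - q) ^ (2 * N)"
  define x where "x = q ^ (N ^ 2)"
  define y where "y = q ^ (2 * N + 1)"
  define w where "w = (-1 :: rat poly fract) ^ N"
  define u v d where "u = 1 + q ^ (2 * N + 1)" and "v = 1 + q ^ (2 * N + 3)" and "d = 1 + q ^ 2"
  have w: "w * w = 1" by (simp add: w_def flip: power_add)
  have nz: "t \<noteq> 0" "x \<noteq> 0" "y \<noteq> 0" "u \<noteq> 0" "v \<noteq> 0" "d \<noteq> 0"
    using q_nonzero one_minus_q_nonzero by (simp_all add: t_def x_def y_def)
      (simp_all only: u_def v_def d_def one_plus_q_power_nonzero not_False_eq_True)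
  have S0_nz: "?S 0 N \<noteq> 0" for N
    using q_nonzero one_minus_q_nonzero norm_nonzero by (simp add: hankel_minor_qEuler)
  have sq: "Suc N * (Suc N - 1) = 2 * N + N * (N - 1)" "(Suc N) ^ 2 = N ^ 2 + (2 * N + 1)"
    "(Suc (Suc N)) * (Suc (Suc N) - 1) = 2 * N + 2 + Suc N * (Suc N - 1)"
    "(Suc N + 1) ^ 2 = N ^ 2 + (2 * N + 1) + (2 * N + 3)"
    by (cases N; simp add: power2_eq_square)+
  have S0: "?S 0 (Suc M) = ?S 0 M * ((-1) ^ M * q ^ (M ^ 2) * norm0 M) / (1 - q) ^ (2 * M)" for M
  proof -
    have "Suc M * (Suc M - 1) = 2 * M + M * (M - 1)" by (cases M) auto
    then show ?thesis unfolding add_0_right hankel_minor_qEuler by (simp only: power_add) simp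
  qed
  have S1: "?S 1 (Suc N) = - (?S 1 N * y * w * x * norm1 N / (d * t))"
    unfolding hankel_minor_qEuler_Suc sq power_add
    by (simp add: t_def x_def w_def d_def y_def power_add mult_ac)
  \<comment> \<open>Two steps of \<open>S0\<close>; the signs of consecutive factors multiply to
    -1.\<close>
  have S0': "?S 0 (N + 2) * (t ^ 2 * (1 - q) ^ 2) = - (?S 0 N * x ^ 2 * y * (norm0 N * norm0 (Suc N)))"
  proof -
    have "?S 0 (N + 2) = ?S 0 N * (w * x * norm0 N) / t * (- w * (x * y) * norm0 (Suc N)) / (t * (1 - q) ^ 2)"
      unfolding add_2_eq_Suc' S0 sq power_add by (simp add: t_def x_def w_def y_def power_add power2_eq_square mult_ac)
    then show ?thesis
      using nz one_minus_q_nonzero by (simp add: power2_eq_square divide_simps) (simp add: mult_ac w)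
  qed
  define B e where "B = 1 + q ^ (2 * N + 2)" and "e = 1 - q ^ (2 * N + 2)"
  have B: "B \<noteq> 0" "1 + q \<noteq> 0"
    using one_plus_q_power_nonzero[of 1] one_plus_q_power_nonzero[of "2 * N + 2"]
    by (simp_all only: B_def power_one_right not_False_eq_True)
  have n0: "norm0 (Suc N) = norm0 N * (e ^ 2 / (u * B ^ 2 * v))"
    by (simp only: norm0_Suc u_def v_def B_def e_def)
  \<comment> \<open>This is \<open>norm1_norm0\<close> with \<open>1 - q ^ 2\<close> factored, so
    that \<open>1 + q\<close> cancels.\<close>
  have "(1 + q) * (norm1 N * (1 - q) * u * B) = (1 + q) * (norm0 N * e * d)"
    using norm1_norm0[of N] by (simp add: u_def B_def e_def d_def algebra_simps power2_eq_square)
  then have n1: "norm1 N * (1 - q) * u * B = norm0 N * e * d"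
    using B by simp
  have "norm0 N * norm0 (Suc N) * (d ^ 2 * v) * (u * B ^ 2) = (norm0 N * e * d) ^ 2"
    using nz B by (simp add: n0 power2_eq_square divide_simps)
  also have "\<dots> = norm1 N ^ 2 * ((1 - q) ^ 2 * u) * (u * B ^ 2)"
    unfolding n1[symmetric] by (simp add: power2_eq_square)
  finally have rel: "norm0 N * norm0 (Suc N) * (d ^ 2 * v) = norm1 N ^ 2 * ((1 - q) ^ 2 * u)"
    using nz B by simp
  have IH: "?S 2 N * ?S 0 N * (x * u) = ?S 1 N ^ 2 * (w + x * y)"
  proof -
    have "(N + 1) ^ 2 = N ^ 2 + (2 * N + 1)" by (simp add: power2_eq_square)
    then have "x * y = q ^ ((N + 1) ^ 2)" unfolding x_def y_def by (simp only: power_add)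
    then show ?thesis using Suc by (simp only: x_def u_def w_def add_0_right)
  qed
  \<comment> \<open>The growth \<open>S0'\<close>, the induction hypothesis and \<open>rel\<close>
    turn the left-hand side of condensation into a multiple of
    \<open>?S 1 (Suc N) ^ 2\<close>.\<close>
  have "?S 0 (N + 2) * ?S 2 N * (x * y * v) * (t ^ 2 * (1 - q) ^ 2 * u * d ^ 2) =
      (?S 0 (N + 2) * (t ^ 2 * (1 - q) ^ 2)) * ?S 2 N * (x * y * v * u * d ^ 2)"
    by (simp only: mult_ac)
  also have "\<dots> = - (?S 2 N * ?S 0 N * (x * u)) * (norm0 N * norm0 (Suc N) * (d ^ 2 * v)) * (x ^ 2 * y ^ 2)"
    unfolding S0' by (simp add: power2_eq_square)
  also have "\<dots> = - ((?S 1 N * y * w * x * norm1 N) ^ 2 * (w + x * y)) * ((1 - q) ^ 2 * u)"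
    unfolding IH rel using w by (simp add: power_mult_distrib power2_eq_square)
  also have "?S 1 N * y * w * x * norm1 N = - (?S 1 (Suc N) * d * t)"
    unfolding S1 using nz by simp
  also have "- ((- (?S 1 (Suc N) * d * t)) ^ 2 * (w + x * y)) * ((1 - q) ^ 2 * u) =
      - (?S 1 (Suc N) ^ 2 * (w + x * y)) * (t ^ 2 * (1 - q) ^ 2 * u * d ^ 2)"
    by (simp add: power_mult_distrib mult_ac)
  finally have *: "?S 0 (N + 2) * ?S 2 N * (x * y * v) = - (?S 1 (Suc N) ^ 2 * (w + x * y))"
    using nz one_minus_q_nonzero
    by (simp only: mult_cancel_right mult_eq_0_iff power_eq_0_iff simp_thms)
  have v: "v = 1 + y * q ^ 2"
    by (simp add: v_def y_def power2_eq_square power3_eq_cube power_add)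
  have "?S 0 (N + 2) * ?S 2 N = ?S 0 (Suc N) * ?S 2 (Suc N) - ?S 1 (Suc N) ^ 2"
    using hankel_minor_condensation[of qEuler N] by simp
  then have "?S 2 (Suc N) * ?S 0 (Suc N) = ?S 0 (N + 2) * ?S 2 N + ?S 1 (Suc N) ^ 2"
    by (simp add: mult.commute)
  then have "?S 2 (Suc N) * ?S 0 (Suc N) * (x * y * v) =
      (?S 0 (N + 2) * ?S 2 N) * (x * y * v) + ?S 1 (Suc N) ^ 2 * (x * y * v)"
    by (simp only: distrib_right)
  \<comment> \<open>Here the sum telescopes: with \<open>v = 1 + y * q ^ 2\<close> the term
    \<open>x * y\<close> cancels, and \<open>x * y * (y * q ^ 2)\<close> is
    \<open>q ^ ((N + 2) ^ 2)\<close>.\<close>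
  also have "\<dots> = ?S 1 (Suc N) ^ 2 * (- w + x * y * (y * q ^ 2))"
    unfolding * unfolding v by (simp add: algebra_simps)
  finally show ?case
    unfolding sq power_add
    by (simp add: x_def y_def v_def w_def power_add power2_eq_square power3_eq_cube mult_ac)
qed

section \<open>Exponents, products and the final closed forms\<close>

text \<open>A quarter of \<open>2 * m choose 3\<close> is therefore the sum of the squares below
  \<open>m\<close>, the exponent collected from the factors \<open>q ^ (k ^ 2)\<close>.\<close>

lemma choose_3_quarter: "(2 * Suc m choose 3) div 4 = (2 * m choose 3) div 4 + m ^ 2"
proof -
  have "2 * Suc m choose 3 = (2 * m choose 3) + (2 * (2 * m choose 2) + 2 * m)"
    by (simp add: numeral_3_eq_3 numeral_2_eq_2)
  also have "2 * (2 * m choose 2) + 2 * m = 4 * m ^ 2"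
    by (cases m) (simp_all add: choose_two power2_eq_square algebra_simps)
  finally show ?thesis by simp
qed

text \<open>The determinant's product starts at index 0 and the claimed one at 1;
  \<open>f 0 = 1\<close> bridges this.\<close>

lemma prod_signed_q_powers:
  assumes "f 0 = 1"
  shows "(\<Prod>k<Suc n. (-1) ^ k * q ^ (k ^ 2) * f k) =
    (-1) ^ ((n + 1) choose 2) * q ^ ((2 * n + 2 choose 3) div 4) * (\<Prod>k = 1..n. f k)"
proof (induction n)
  case 0
  show ?case using assms by (simp add: numeral_2_eq_2 numeral_3_eq_3)
next
  case (Suc n)
  have e: "Suc n + 1 choose 2 = (n + 1 choose 2) + Suc n"
    by (simp add: numeral_2_eq_2)
  have e': "(2 * Suc n + 2 choose 3) div 4 = (2 * n + 2 choose 3) div 4 + (Suc n) ^ 2"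
    using choose_3_quarter[of "Suc n"] by simp
  have "(\<Prod>k = 1..Suc n. f k) = (\<Prod>k = 1..n. f k) * f (Suc n)"
    by simp
  then show ?case
    unfolding prod.lessThan_Suc[of _ "Suc n"] Suc e e' power_add by (simp only: mult_ac)
qed

text \<open>In the product of \<open>norm0_norm2\<close> over \<open>k\<close> the factors
  \<open>1 + q ^ (2 * k + 1)\<close> telescope, leaving one more \<open>1 + q ^ 3\<close> on the
  right.\<close>

lemma prod_norm0_norm2:
  "(\<Prod>k = 1..n. norm2 k) * (\<Prod>k = 1..n. norm0 k) * ((1 + q) ^ n * (1 + q ^ (2 * n + 3))) =
    (\<Prod>k = 1..n. norm1 k) ^ 2 * (1 + q ^ 3) ^ (n + 1)"
proof (induction n)
  case 0
  show ?case by simp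
next
  case (Suc n)
  have e: "2 * Suc n + 1 = 2 * n + 3" by simp
  let ?P = "\<lambda>f. \<Prod>k = 1..n. f k :: rat poly fract"
  have P: "(\<Prod>k = 1..Suc n. f k) = ?P f * f (Suc n)" for f
    by simp
  have "?P norm2 * norm2 (Suc n) * (?P norm0 * norm0 (Suc n)) *
      ((1 + q) ^ Suc n * (1 + q ^ (2 * Suc n + 3))) * (1 + q ^ (2 * n + 3)) =
    (?P norm2 * ?P norm0 * ((1 + q) ^ n * (1 + q ^ (2 * n + 3)))) *
      (norm2 (Suc n) * norm0 (Suc n) * ((1 + q) * (1 + q ^ (2 * Suc n + 3))))"
    by (simp only: power_Suc mult_ac)
  also have "\<dots> = ((?P norm1 * norm1 (Suc n)) ^ 2 * (1 + q ^ 3) ^ (Suc n + 1)) * (1 + q ^ (2 * n + 3))"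
    unfolding Suc norm0_norm2 e by (simp only: power_mult_distrib power_Suc Suc_eq_plus1[symmetric] mult_ac)
  finally show ?case
    unfolding P using one_plus_q_power_nonzero[of "2 * n + 3"] by (simp only: mult_cancel_right simp_thms)
qed

theorem theorem1p1:
  fixes n :: nat
  shows
    "hankel_det (\<lambda>m. qEuler m) n =
       (-1) ^ ((n + 1) choose 2) * q ^ ((2 * n + 2 choose 3) div 4) / (1 - q) ^ (n * (n + 1)) *
       (\<Prod>k = 1..n. qpochs [q ^ 2, q ^ 2] (q ^ 2) k /
                    qpochs [- q, - (q ^ 2), - (q ^ 2), - (q ^ 3)] (q ^ 2) k) \<and>
     hankel_det (\<lambda>m. qEuler (m + 1)) n =
       (-1) ^ ((n + 2) choose 2) * q ^ ((2 * n + 4 choose 3) div 4) /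
         ((1 - q) ^ (n * (n + 1)) * (1 + q ^ 2) ^ (n + 1)) *
       (\<Prod>k = 1..n. qpochs [q ^ 2, q ^ 4] (q ^ 2) k /
                    qpochs [- (q ^ 2), - (q ^ 3), - (q ^ 3), - (q ^ 4)] (q ^ 2) k) \<and>
     hankel_det (\<lambda>m. qEuler (m + 2)) n =
       (-1) ^ ((n + 2) choose 2) * q ^ ((2 * n + 4 choose 3) div 4) *
         (1 + q) ^ n * (1 - (-1) ^ n * q ^ ((n + 2) ^ 2)) /
         ((1 - q) ^ (n * (n + 1)) * (1 + q ^ 2) ^ (2 * (n + 1)) * (1 + q ^ 3) ^ (n + 1)) *
       (\<Prod>k = 1..n. qpochs [q ^ 4, q ^ 4] (q ^ 2) k /
                    qpochs [- (q ^ 3), - (q ^ 4), - (q ^ 4), - (q ^ 5)] (q ^ 2) k)"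
  (is "?L0 = ?R0 \<and> ?L1 = ?R1 \<and> ?L2 = ?R2")
proof -
  define s s' a a' l D T where "s = (-1 :: rat poly fract) ^ ((n + 1) choose 2)"
    and "s' = (-1 :: rat poly fract) ^ ((n + 2) choose 2)"
    and "a = q ^ ((2 * n + 2 choose 3) div 4)" and "a' = q ^ ((2 * n + 4 choose 3) div 4)"
    and "l = (1 - q) ^ (n * (n + 1))" and "D = (1 + q ^ 2) ^ (n + 1)" and "T = (1 + q ^ 3) ^ (n + 1)"
  define P0 P1 P2 where "P0 = (\<Prod>k = 1..n. norm0 k)" and "P1 = (\<Prod>k = 1..n. norm1 k)"
    and "P2 = (\<Prod>k = 1..n. norm2 k)"
  define b where "b = q ^ ((n + 1) ^ 2)"
  define w where "w = (-1 :: rat poly fract) ^ (n + 1)"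
  define r where "r = 1 + q ^ (2 * n + 3)"
  have nz: "a \<noteq> 0" "l \<noteq> 0" "D \<noteq> 0" "T \<noteq> 0" "b \<noteq> 0" "r \<noteq> 0" "P0 \<noteq> 0" "s \<noteq> 0"
    using q_nonzero one_minus_q_nonzero one_plus_q_power_nonzero norm_nonzero
    by (simp_all add: a_def l_def D_def T_def b_def r_def P0_def s_def)
  have s': "s' = w * s"
    by (simp add: s'_def s_def w_def numeral_2_eq_2 flip: power_add)
  have ss: "s * s = 1" "w * w = 1"
    by (simp_all add: s_def w_def flip: power_add)
  have a': "a' = a * b"
  proof -
    have "2 * Suc (Suc n) = 2 * n + 4" "2 * Suc n = 2 * n + 2" "Suc n = n + 1" by auto
    with choose_3_quarter[of "Suc n"] show ?thesis
      by (simp only: a'_def a_def b_def power_add)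
  qed
  have R0: "?R0 = s * a / l * P0"
    by (simp only: s_def a_def l_def P0_def norm0_def)
  have R1: "?R1 = s' * a' / (l * D) * P1"
    by (simp only: s'_def a'_def l_def D_def P1_def norm1_def)
  have R2: "?R2 = s' * a' * (1 + q) ^ n * (1 - (-1) ^ n * q ^ ((n + 2) ^ 2)) / (l * D ^ 2 * T) * P2"
    by (simp only: s'_def a'_def l_def D_def T_def P2_def norm2_def power_mult[symmetric] mult.commute[of _ 2])
  have L0: "?L0 = s * a / l * P0"
    unfolding hankel_det_conv_minor hankel_minor_qEuler
    by (subst prod_signed_q_powers)
      (simp_all add: s_def a_def l_def P0_def norm0_def qpochs_def mult.commute)
  have "Suc n + Suc n * (Suc n - 1) = (n + 1) ^ 2"
    by (simp add: power2_eq_square)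
  then have b: "q ^ Suc n * q ^ (Suc n * (Suc n - 1)) = b"
    unfolding b_def by (simp only: power_add[symmetric])
  \<comment> \<open>This prefactor of the second determinant supplies the \<open>w * b\<close> that
    turns \<open>s * a\<close> into \<open>s' * a'\<close>.\<close>
  have "(- q / (1 + q ^ 2)) ^ Suc n * q ^ (Suc n * (Suc n - 1)) =
      (-1) ^ Suc n * (q ^ Suc n * q ^ (Suc n * (Suc n - 1))) / D"
  proof -
    have "- q / (1 + q ^ 2) = (-1) * q / (1 + q ^ 2)" by simp
    then show ?thesis
      by (simp only: D_def power_divide power_mult_distrib Suc_eq_plus1 times_divide_eq_left
          times_divide_eq_right mult_ac)
  qed
  also have "\<dots> = w * b / D"
    unfolding b by (simp add: w_def)
  finally have L1: "?L1 = s' * a' / (l * D) * P1"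
    unfolding hankel_det_conv_minor hankel_minor_qEuler_Suc s' a'
    by (subst prod_signed_q_powers)
      (simp_all add: s_def a_def l_def P1_def norm1_def qpochs_def mult_ac del: power_Suc)
  have P: "P2 * P0 * ((1 + q) ^ n * r) = P1 ^ 2 * T"
    unfolding P0_def P1_def P2_def r_def T_def by (rule prod_norm0_norm2)
  \<comment> \<open>Since \<open>(-1) ^ n = - w\<close> and \<open>w * w = 1\<close>, the bracket of
    the claim is \<open>w\<close> times the one from condensation.\<close>
  have w': "1 - (-1) ^ n * q ^ ((n + 2) ^ 2) = w * (w + q ^ ((n + 2) ^ 2))"
    using ss(2) by (simp add: w_def algebra_simps)
  have "?L2 * ?L0 * (b * r) = ?L1 ^ 2 * (w + q ^ ((n + 2) ^ 2))"
    using hankel_minor_qEuler_Suc_Suc[of "n + 1"]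
    by (simp add: hankel_det_conv_minor b_def r_def w_def numeral_3_eq_3)
  \<comment> \<open>The fraction is expanded by \<open>T\<close>, so that \<open>P\<close> can
    replace \<open>P1 ^ 2 * T\<close>.\<close>
  also have "\<dots> = (P1 ^ 2 * T) * (s' ^ 2 * a' ^ 2 * (w + q ^ ((n + 2) ^ 2)) / (l ^ 2 * D ^ 2 * T))"
    unfolding L1 using nz by (simp add: power_mult_distrib power_divide)
  also have "\<dots> = ?R2 * ?L0 * (b * r)"
    unfolding P[symmetric] R2 L0 unfolding w' s' a' using nz by (simp add: power2_eq_square ss mult_ac)
  finally have "?L2 * ?L0 * (b * r) = ?R2 * ?L0 * (b * r)" .
  moreover have "?L0 \<noteq> 0"
    unfolding L0 using nz by simp
  ultimately have "?L2 = ?R2"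
    using nz by (simp only: mult_cancel_right mult_eq_0_iff simp_thms)
  then show ?thesis
    unfolding R0 R1 L0 L1 by simp
qed

end
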